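(* Let $T_1$ and $T_2$ be two trees, each having at least one edge. Then $$\chi_s'(T_1\Box T_2)\ \ge\ \max\{2\Delta(T_1)+\Delta'(T_2),\ 2\Delta(T_2)+\Delta'(T_1)\}+1=\Delta'(T_1\Box T_2)+1.$$
   Context: $\Delta(G)$ is the maximum degree of $G$. For an edge $uv$ of $G$ its edge degree is $d'(u,v)=d(u)+d(v)-1$ (the number of edges incident to $u$ or $v$), and $\Delta'(G)$ is the maximum edge degree over all edges of $G$. The Cartesian product $G\Box H$ has vertex set $V(G)\times V(H)$, with $(a,u)\sim(b,v)$ iff either $a=b$ and $uv\in E(H)$, or $u=v$ and $ab\in E(G)$. A strong edge coloring is a proper edge coloring in which every color class is an induced matching; $\chi_s'(G)$ is the minimum number of colors in such a coloring. *)

theory Defs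
  imports
    "Graph_Theory.Digraph_Component"
    "Graph_Theory.Pair_Digraph"
begin

text \<open>
  A finite simple graph is a \<^locale>\<open>pair_graph\<close>: a finite loop-free digraph with symmetric arc
  relation. An undirected edge \<open>uv\<close> is thus a pair of opposite arcs, and is identified with the
  two-element set \<open>{u, v}\<close>.
\<close>

definition edges :: "'a pair_pre_digraph \<Rightarrow> 'a set set" where
  "edges G = {{u, v} |u v. (u, v) \<in> parcs G}"

text \<open>
  The library predicate \<^const>\<open>tree\<close> is unsuitable for symmetric digraphs: going back and forth
  along an edge is a directed cycle of length 2. Directed cycles of length at least 3 are
  exactly the traversals of the cycles of the underlying undirected graph.
\<close>

definition undirected_tree :: "'a pair_pre_digraph \<Rightarrow> bool" where
  "undirected_tree G \<longleftrightarrow>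
     pair_graph G \<and> Digraph_Component.connected (with_proj G) \<and>
     \<not> (\<exists>p. pre_digraph.cycle (with_proj G) p \<and> length p \<ge> 3)"

text \<open>
  In a symmetric digraph without parallel arcs, every edge at \<open>v\<close> contributes exactly one
  outgoing arc, so the out-degree is the degree of \<open>v\<close> in the undirected graph.
\<close>

abbreviation degree :: "'a pair_pre_digraph \<Rightarrow> 'a \<Rightarrow> nat" where
  "degree G v \<equiv> out_degree (with_proj G) v"

definition max_degree :: "'a pair_pre_digraph \<Rightarrow> nat" where
  "max_degree G = Max {degree G v |v. v \<in> pverts G}"

definition edge_degree :: "'a pair_pre_digraph \<Rightarrow> 'a \<Rightarrow> 'a \<Rightarrow> nat" where
  "edge_degree G u v = degree G u + degree G v - 1"

text \<open>Only meaningful for graphs with at least one edge.\<close>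

definition max_edge_degree :: "'a pair_pre_digraph \<Rightarrow> nat" where
  "max_edge_degree G = Max {edge_degree G u v |u v. (u, v) \<in> parcs G}"

definition cartesian_product ::
  "'a pair_pre_digraph \<Rightarrow> 'b pair_pre_digraph \<Rightarrow> ('a \<times> 'b) pair_pre_digraph"
  (infixl \<open>\<box>\<close> 70) where
  "G \<box> H =
     \<lparr> pverts = pverts G \<times> pverts H,
       parcs = {((a, u), (b, v)) |a u b v.
         a \<in> pverts G \<and> b \<in> pverts G \<and> u \<in> pverts H \<and> v \<in> pverts H \<and>
         (a = b \<and> (u, v) \<in> parcs H \<or> u = v \<and> (a, b) \<in> parcs G)} \<rparr>"

definition proper_edge_coloring :: "'a pair_pre_digraph \<Rightarrow> ('a set \<Rightarrow> 'c) \<Rightarrow> bool" where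
  "proper_edge_coloring G c \<longleftrightarrow>
     (\<forall>e \<in> edges G. \<forall>f \<in> edges G. e \<noteq> f \<and> e \<inter> f \<noteq> {} \<longrightarrow> c e \<noteq> c f)"

definition matching :: "'a pair_pre_digraph \<Rightarrow> 'a set set \<Rightarrow> bool" where
  "matching G M \<longleftrightarrow> M \<subseteq> edges G \<and> (\<forall>e \<in> M. \<forall>f \<in> M. e \<noteq> f \<longrightarrow> e \<inter> f = {})"

text \<open>A matching is induced if it contains every edge of \<open>G\<close> between vertices it covers.\<close>

definition induced_matching :: "'a pair_pre_digraph \<Rightarrow> 'a set set \<Rightarrow> bool" where
  "induced_matching G M \<longleftrightarrow> matching G M \<and> {e \<in> edges G. e \<subseteq> \<Union> M} = M"

definition strong_edge_coloring :: "'a pair_pre_digraph \<Rightarrow> ('a set \<Rightarrow> 'c) \<Rightarrow> bool" where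
  "strong_edge_coloring G c \<longleftrightarrow>
     proper_edge_coloring G c \<and>
     (\<forall>k \<in> c ` edges G. induced_matching G {e \<in> edges G. c e = k})"

text \<open>
  Natural numbers suffice as colors since the edge set is finite; for the same reason an
  injective coloring shows that the minimum is attained.
\<close>

definition strong_chromatic_index :: "'a pair_pre_digraph \<Rightarrow> nat" where
  "strong_chromatic_index G =
     (LEAST n. \<exists>c :: 'a set \<Rightarrow> nat. strong_edge_coloring G c \<and> card (c ` edges G) = n)"

end

theory Submission
  imports Defs
begin

text \<open>
  Only a square \<open>(a, u), (a, v), (b, v), (b, u)\<close> of the product matters, with \<open>uv\<close> an edge of
  maximum edge degree and \<open>a\<close> a vertex of maximum degree in the other factor. The edges that meet
  the side \<open>(a, u)(a, v)\<close> pairwise share a vertex or are joined by that side, and each of them is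
  joined to the opposite side \<open>(b, u)(b, v)\<close> by an edge of the square. So all these edges, including
  the opposite side, need different colors.
\<close>

section \<open>Edges counted by degrees and edge degrees\<close>

lemma edges_iff:
  assumes "pair_graph G"
  shows "{u, v} \<in> edges G \<longleftrightarrow> (u, v) \<in> parcs G"
proof -
  interpret pair_graph G by fact
  show ?thesis
    unfolding edges_def by (auto simp: doubleton_eq_iff intro: arcs_symmetric)
qed

lemma edgesE:
  assumes "e \<in> edges G"
  obtains u v where "e = {u, v}" "(u, v) \<in> parcs G"
  using assms unfolding edges_def by blast

lemma finite_edges:
  assumes "pair_graph G"
  shows "finite (edges G)"
proof -
  interpret pair_graph G by fact
  have "edges G = (\<lambda>(u, v). {u, v}) ` parcs G"
    unfolding edges_def by auto
  then show ?thesis by simp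
qed

lemma degree_alt: "degree G v = card {w. (v, w) \<in> parcs G}"
proof -
  have "out_arcs (with_proj G) v = Pair v ` {w. (v, w) \<in> parcs G}"
    by (auto simp: out_arcs_def)
  then show ?thesis
    by (simp add: out_degree_def card_image inj_on_def)
qed

lemma finite_neighbors:
  assumes "pair_graph G"
  shows "finite {w. (v, w) \<in> parcs G}"
proof -
  interpret pair_graph G by fact
  have "{w. (v, w) \<in> parcs G} \<subseteq> snd ` parcs G"
    by force
  then show ?thesis
    by (rule finite_subset) simp
qed

text \<open>Edge degrees subtract 1 in the natural numbers; a positive degree at one end keeps this
  subtraction from being truncated.\<close>

lemma degree_pos:
  assumes "pair_graph G" "(u, v) \<in> parcs G"
  shows "degree G u \<ge> 1"
  using finite_neighbors[OF assms(1), of u] assms(2)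
  by (auto simp: degree_alt Suc_le_eq card_gt_0_iff)

text \<open>The map from a neighbor \<open>w\<close> to \<open>{v, w}\<close> is injective and its
  image is the set of edges at \<open>v\<close>. This passes from arcs to the undirected edges that
  a coloring sees.\<close>

lemma degree_eq_card_incident_edges:
  assumes "pair_graph G"
  shows "degree G v = card {e \<in> edges G. v \<in> e}"
proof -
  interpret pair_graph G by fact
  have "{e \<in> edges G. v \<in> e} = (\<lambda>w. {v, w}) ` {w. (v, w) \<in> parcs G}"
    unfolding edges_def by (auto intro: arcs_symmetric simp: insert_commute)
  moreover have "inj_on (\<lambda>w. {v, w}) {w. (v, w) \<in> parcs G}"
    by (auto simp: inj_on_def doubleton_eq_iff)
  ultimately show ?thesis
    by (simp add: degree_alt card_image)
qed

text \<open>Inclusion-exclusion on the edges at \<open>p\<close> and the edges at \<open>q\<close>: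
  without loops \<open>p\<close> and \<open>q\<close> differ, so only \<open>{p, q}\<close> lies in
  both sets and is counted twice.\<close>

lemma edge_degree_eq_card_incident_edges:
  assumes "pair_graph G" "(p, q) \<in> parcs G"
  shows "edge_degree G p q = card {e \<in> edges G. p \<in> e \<or> q \<in> e}"
proof -
  interpret pair_graph G by fact
  let ?P = "{e \<in> edges G. p \<in> e}" and ?Q = "{e \<in> edges G. q \<in> e}"
  have fin: "finite ?P" "finite ?Q"
    using finite_edges[OF assms(1)] by simp_all
  have "p \<noteq> q"
    using assms(2) no_loops' by auto
  then have "?P \<inter> ?Q = {{p, q}}"
    using assms edges_iff[OF assms(1)] by (auto elim!: edgesE)
  moreover have "?P \<union> ?Q = {e \<in> edges G. p \<in> e \<or> q \<in> e}"
    by auto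
  ultimately show ?thesis
    using card_Un_Int[OF fin]
    by (simp add: edge_degree_def degree_eq_card_incident_edges[OF assms(1)])
qed

section \<open>Strong edge colorings and the strong chromatic index\<close>

lemma ex_strong_edge_coloring:
  fixes G :: "'a pair_pre_digraph"
  assumes "pair_graph G"
  shows "\<exists>c :: 'a set \<Rightarrow> nat. strong_edge_coloring G c"
proof -
  interpret pair_graph G by fact
  \<comment> \<open>A coloring that gives every edge its own color; each color class is then a
    single edge.\<close>
  obtain c :: "'a set \<Rightarrow> nat" where c: "inj_on c (edges G)"
    using finite_imp_inj_to_nat_seg[OF finite_edges[OF assms]] by auto
  have "induced_matching G {f \<in> edges G. c f = c e}" if e: "e \<in> edges G" for e
  proof -
    have "{f \<in> edges G. c f = c e} = {e}"
      using c e by (auto simp: inj_on_def)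
    \<comment> \<open>Without loops every edge has exactly two ends, so an edge contained in another
      equals it. Hence a single edge is an induced matching.\<close>
    moreover have "f = e" if "f \<in> edges G" "f \<subseteq> e" for f
      using e that no_loops' by (auto elim!: edgesE)
    ultimately show ?thesis
      using e by (auto simp: induced_matching_def matching_def)
  qed
  then have "strong_edge_coloring G c"
    using c by (auto simp: strong_edge_coloring_def proper_edge_coloring_def inj_on_def)
  then show ?thesis by blast
qed

text \<open>Some strong edge coloring exists, so the \<open>LEAST\<close> is attained by one, and a
  bound valid for all colorings applies to it.\<close>

lemma strong_chromatic_index_geI:
  fixes G :: "'a pair_pre_digraph"
  assumes "pair_graph G"
    and "\<And>c :: 'a set \<Rightarrow> nat. strong_edge_coloring G c \<Longrightarrow> n \<le> card (c ` edges G)"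
  shows "n \<le> strong_chromatic_index G"
proof -
  have "\<exists>c :: 'a set \<Rightarrow> nat. strong_edge_coloring G c
      \<and> card (c ` edges G) = strong_chromatic_index G"
    unfolding strong_chromatic_index_def
    by (rule LeastI_ex) (use ex_strong_edge_coloring[OF assms(1)] in blast)
  then show ?thesis
    using assms(2) by metis
qed

text \<open>A shared vertex is excluded by properness. Otherwise, if the colors agreed, the edge
  \<open>{p, q}\<close> would be spanned by the color class and hence belong to it. The class is a
  matching, so \<open>{p, q}\<close> would coincide with \<open>e\<close> through \<open>p\<close>
  and with \<open>f\<close> through \<open>q\<close>, contradicting that these differ.\<close>

lemma strong_edge_coloring_joined_neq:
  assumes c: "strong_edge_coloring G c"
    and e: "e \<in> edges G" "p \<in> e" and f: "f \<in> edges G" "q \<in> f"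
    and pq: "p = q \<or> {p, q} \<in> edges G" and "e \<noteq> f"
  shows "c e \<noteq> c f"
proof
  assume eq: "c e = c f"
  show False
  proof (cases "p = q")
    case True
    then show False
      using assms eq unfolding strong_edge_coloring_def proper_edge_coloring_def by blast
  next
    case False
    let ?M = "{g \<in> edges G. c g = c e}"
    have M: "induced_matching G ?M"
      using c e by (auto simp: strong_edge_coloring_def)
    have "{p, q} \<subseteq> \<Union> ?M"
      using e f eq by auto
    then have "{p, q} \<in> ?M"
      using M pq False unfolding induced_matching_def by blast
    moreover have "e \<in> ?M" "f \<in> ?M"
      using e f eq by auto
    moreover have "g = h" if "g \<in> ?M" "h \<in> ?M" "x \<in> g" "x \<in> h" for g h x
      using M that unfolding induced_matching_def matching_def by blast
    ultimately have "{p, q} = e" "{p, q} = f"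
      using e(2) f(2) by (meson insertI1 insertI2)+
    then show False
      using \<open>e \<noteq> f\<close> by simp
  qed
qed

lemma strong_chromatic_index_square:
  assumes G: "pair_graph G"
    and arcs: "(p, q) \<in> parcs G" "(q, r) \<in> parcs G" "(r, s) \<in> parcs G" "(s, p) \<in> parcs G"
    and "p \<noteq> r" "q \<noteq> s"
  shows "edge_degree G p q + 1 \<le> strong_chromatic_index G"
proof (rule strong_chromatic_index_geI[OF G])
  fix c :: "'a set \<Rightarrow> nat"
  assume c: "strong_edge_coloring G c"
  interpret pair_graph G by fact
  let ?I = "{e \<in> edges G. p \<in> e \<or> q \<in> e}"
  have sides: "{p, q} \<in> edges G" "{q, r} \<in> edges G" "{r, s} \<in> edges G" "{p, s} \<in> edges G"
    using arcs edges_iff[OF G] by (simp_all add: arcs_symmetric)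
  have inj: "inj_on c ?I"
  proof (rule inj_onI, rule ccontr)
    fix e f assume *: "e \<in> ?I" "f \<in> ?I" "c e = c f" "e \<noteq> f"
    \<comment> \<open>Each of the two edges has an end on the side \<open>{p, q}\<close>; these ends
      are equal or are joined by that side.\<close>
    then obtain x y where "x \<in> e" "y \<in> f" "x \<in> {p, q}" "y \<in> {p, q}"
      by blast
    moreover from this have "x = y \<or> {x, y} \<in> edges G"
      using sides by (auto simp: insert_commute)
    ultimately show False
      using strong_edge_coloring_joined_neq[OF c] * by blast
  qed
  \<comment> \<open>Consecutive corners of the square differ because there are no loops, opposite
    ones by assumption. So \<open>{r, s}\<close> avoids \<open>p\<close> and \<open>q\<close> and
    adds one to the count.\<close>
  have rs: "{r, s} \<notin> ?I"
    using assms no_loops' by auto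
  have neq: "c e \<noteq> c {r, s}" if "e \<in> ?I" for e
  proof -
    have "e \<noteq> {r, s}"
      using rs that by blast
    \<comment> \<open>An edge through \<open>p\<close> is joined to \<open>{r, s}\<close> by the
      side \<open>{p, s}\<close>, one through \<open>q\<close> by the side
      \<open>{q, r}\<close>.\<close>
    then show ?thesis
      using that sides strong_edge_coloring_joined_neq[OF c, of e p "{r, s}" s]
        strong_edge_coloring_joined_neq[OF c, of e q "{r, s}" r]
      by auto
  qed
  have fin: "finite (edges G)"
    by (rule finite_edges[OF G])
  have "c {r, s} \<notin> c ` ?I"
    using neq by (metis (no_types, lifting) imageE)
  then have "inj_on c (insert {r, s} ?I)"
    using inj by (auto simp: inj_on_insert)
  then have "card (insert {r, s} ?I) \<le> card (c ` edges G)"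
    using card_image[of c "insert {r, s} ?I"] sides fin
    by (metis (no_types, lifting) card_mono finite_imageI image_mono insert_subset mem_Collect_eq subsetI)
  then show "edge_degree G p q + 1 \<le> card (c ` edges G)"
    using fin rs edge_degree_eq_card_incident_edges[OF G arcs(1)] by simp
qed

section \<open>Arcs, degrees and edge degrees of the Cartesian product\<close>

lemma pair_graph_cartesian_product:
  assumes "pair_graph G" "pair_graph H"
  shows "pair_graph (G \<box> H)"
proof -
  interpret G: pair_graph G by fact
  interpret H: pair_graph H by fact
  have "parcs (G \<box> H) \<subseteq> pverts (G \<box> H) \<times> pverts (G \<box> H)"
    by (auto simp: cartesian_product_def)
  moreover have fin: "finite (pverts (G \<box> H))"
    by (simp add: cartesian_product_def)
  ultimately have "finite (parcs (G \<box> H))"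
    using finite_subset by blast
  then show ?thesis
    using fin G.no_loops' H.no_loops'
    by unfold_locales
      (auto simp: cartesian_product_def symmetric_def sym_def intro: G.arcs_symmetric H.arcs_symmetric)
qed

text \<open>The ends of an arc of a factor are vertices of it, so the only membership left to state
  concerns the coordinate that stays fixed.\<close>

lemma arcs_cartesian_product:
  assumes "pair_graph G" "pair_graph H"
  shows "((a, u), (b, v)) \<in> parcs (G \<box> H) \<longleftrightarrow>
    a = b \<and> a \<in> pverts G \<and> (u, v) \<in> parcs H \<or> u = v \<and> u \<in> pverts H \<and> (a, b) \<in> parcs G"
proof -
  interpret G: pair_graph G by fact
  interpret H: pair_graph H by fact
  show ?thesis
    by (auto simp: cartesian_product_def dest: G.in_arcsD1 G.in_arcsD2 H.in_arcsD1 H.in_arcsD2)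
qed

lemma degree_cartesian_product:
  assumes G: "pair_graph G" and H: "pair_graph H" and "a \<in> pverts G" "u \<in> pverts H"
  shows "degree (G \<box> H) (a, u) = degree G a + degree H u"
proof -
  interpret G: pair_graph G by fact
  let ?A = "{b. (a, b) \<in> parcs G}" and ?B = "{v. (u, v) \<in> parcs H}"
  have "{w. ((a, u), w) \<in> parcs (G \<box> H)} = (\<lambda>b. (b, u)) ` ?A \<union> Pair a ` ?B"
    using assms(3,4) by (auto simp: arcs_cartesian_product[OF G H])
  \<comment> \<open>A common neighbor would have to be \<open>(a, u)\<close> itself, which would
    require a loop at \<open>a\<close>.\<close>
  moreover have "(\<lambda>b. (b, u)) ` ?A \<inter> Pair a ` ?B = {}"
    using G.no_loops' by auto
  ultimately show ?thesis
    using finite_neighbors[OF G, of a] finite_neighbors[OF H, of u]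
    by (simp add: degree_alt card_Un_disjoint card_image inj_on_def)
qed

text \<open>The fixed coordinate contributes its degree at both ends, hence the factor 2; the moving
  coordinate contributes the edge degree in its own factor.\<close>

lemma edge_degree_cartesian_product:
  assumes G: "pair_graph G" and H: "pair_graph H"
  shows "a \<in> pverts G \<Longrightarrow> (u, v) \<in> parcs H \<Longrightarrow>
      edge_degree (G \<box> H) (a, u) (a, v) = 2 * degree G a + edge_degree H u v"
    and "u \<in> pverts H \<Longrightarrow> (a, b) \<in> parcs G \<Longrightarrow>
      edge_degree (G \<box> H) (a, u) (b, u) = 2 * degree H u + edge_degree G a b"
proof -
  interpret G: pair_graph G by fact
  interpret H: pair_graph H by fact
  show "edge_degree (G \<box> H) (a, u) (a, v) = 2 * degree G a + edge_degree H u v"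
    if "a \<in> pverts G" "(u, v) \<in> parcs H"
    using that degree_pos[OF H that(2)] H.in_arcsD1[OF that(2)] H.in_arcsD2[OF that(2)]
    by (simp add: edge_degree_def degree_cartesian_product[OF G H])
  show "edge_degree (G \<box> H) (a, u) (b, u) = 2 * degree H u + edge_degree G a b"
    if "u \<in> pverts H" "(a, b) \<in> parcs G"
    using that degree_pos[OF G that(2)] G.in_arcsD1[OF that(2)] G.in_arcsD2[OF that(2)]
    by (simp add: edge_degree_def degree_cartesian_product[OF G H])
qed

section \<open>The maximum degree and the maximum edge degree as attained bounds\<close>

lemma finite_degrees:
  assumes "pair_graph G"
  shows "finite {degree G v |v. v \<in> pverts G}"
proof -
  interpret pair_graph G by fact
  show ?thesis by simp
qed

lemma finite_edge_degrees:
  assumes "pair_graph G"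
  shows "finite {edge_degree G u v |u v. (u, v) \<in> parcs G}"
proof -
  interpret pair_graph G by fact
  have "{edge_degree G u v |u v. (u, v) \<in> parcs G} = (\<lambda>(u, v). edge_degree G u v) ` parcs G"
    by auto
  then show ?thesis by simp
qed

lemma degree_le_max_degree:
  assumes "pair_graph G" "v \<in> pverts G"
  shows "degree G v \<le> max_degree G"
  unfolding max_degree_def using assms by (intro Max_ge finite_degrees) auto

lemma edge_degree_le_max_edge_degree:
  assumes "pair_graph G" "(u, v) \<in> parcs G"
  shows "edge_degree G u v \<le> max_edge_degree G"
  unfolding max_edge_degree_def using assms by (intro Max_ge finite_edge_degrees) auto

lemma max_edge_degree_attained:
  assumes "pair_graph G" "edges G \<noteq> {}"
  obtains u v where "(u, v) \<in> parcs G" "edge_degree G u v = max_edge_degree G"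
proof -
  have "{edge_degree G u v |u v. (u, v) \<in> parcs G} \<noteq> {}"
    using assms(2) by (auto simp: edges_def)
  then show thesis
    using that Max_in[OF finite_edge_degrees[OF assms(1)]] unfolding max_edge_degree_def by auto
qed

text \<open>Besides the vertex \<open>a\<close> of maximum degree a neighbor \<open>b\<close> is
  supplied, since a square in the product needs an edge of each factor.\<close>

lemma max_degree_attained:
  assumes G: "pair_graph G" and "edges G \<noteq> {}"
  obtains a b where "(a, b) \<in> parcs G" "degree G a = max_degree G"
proof -
  interpret pair_graph G by fact
  obtain x y where xy: "(x, y) \<in> parcs G"
    using assms(2) by (auto simp: edges_def)
  then have x: "x \<in> pverts G"
    by (rule in_arcsD1)
  then have "{degree G v |v. v \<in> pverts G} \<noteq> {}"
    by auto
  then have "max_degree G \<in> {degree G v |v. v \<in> pverts G}"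
    unfolding max_degree_def by (rule Max_in[OF finite_degrees[OF G]])
  then obtain a where a: "degree G a = max_degree G"
    by force
  \<comment> \<open>The end \<open>x\<close> of an edge already has degree at least 1, and
    \<open>a\<close> has at least the degree of \<open>x\<close>.\<close>
  have "card {b. (a, b) \<in> parcs G} \<ge> 1"
    using degree_pos[OF G xy] degree_le_max_degree[OF G x] a degree_alt[of G a] by linarith
  then have "{b. (a, b) \<in> parcs G} \<noteq> {}"
    by force
  then show thesis
    using that a by blast
qed

section \<open>Lower bound from two squares, and the maximum edge degree of the product\<close>

theorem theorem5:
  fixes T1 :: "'a pair_pre_digraph" and T2 :: "'b pair_pre_digraph"
  assumes "undirected_tree T1" and "undirected_tree T2"
    and "edges T1 \<noteq> {}" and "edges T2 \<noteq> {}"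
  shows "strong_chromatic_index (T1 \<box> T2) \<ge>
           max (2 * max_degree T1 + max_edge_degree T2) (2 * max_degree T2 + max_edge_degree T1) + 1
       \<and> max (2 * max_degree T1 + max_edge_degree T2) (2 * max_degree T2 + max_edge_degree T1) + 1
           = max_edge_degree (T1 \<box> T2) + 1"
proof -
  have G: "pair_graph T1" and H: "pair_graph T2"
    using assms(1,2) by (simp_all add: undirected_tree_def)
  interpret G: pair_graph T1 by fact
  interpret H: pair_graph T2 by fact
  note P = pair_graph_cartesian_product[OF G H]
  note arcs_iff = arcs_cartesian_product[OF G H]
  note edge_degree = edge_degree_cartesian_product[OF G H]
  let ?m1 = "2 * max_degree T1 + max_edge_degree T2"
    and ?m2 = "2 * max_degree T2 + max_edge_degree T1"
  \<comment> \<open>The edges \<open>ab\<close> and \<open>uv\<close> span the square for the first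
    term of the maximum, with \<open>b\<close> an arbitrary neighbor of \<open>a\<close>. The edges
    \<open>st\<close> and \<open>xy\<close> do the same for the second term with the factors
    exchanged.\<close>
  obtain a b where ab: "(a, b) \<in> parcs T1" "degree T1 a = max_degree T1"
    using max_degree_attained[OF G assms(3)] .
  obtain u v where uv: "(u, v) \<in> parcs T2" "edge_degree T2 u v = max_edge_degree T2"
    using max_edge_degree_attained[OF H assms(4)] .
  obtain x y where xy: "(x, y) \<in> parcs T2" "degree T2 x = max_degree T2"
    using max_degree_attained[OF H assms(4)] .
  obtain s t where st: "(s, t) \<in> parcs T1" "edge_degree T1 s t = max_edge_degree T1"
    using max_edge_degree_attained[OF G assms(3)] .
  have verts: "a \<in> pverts T1" "b \<in> pverts T1" "s \<in> pverts T1" "t \<in> pverts T1"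
    "u \<in> pverts T2" "v \<in> pverts T2" "x \<in> pverts T2" "y \<in> pverts T2"
    using ab st uv xy by (auto dest: G.in_arcsD1 G.in_arcsD2 H.in_arcsD1 H.in_arcsD2)
  have neq: "a \<noteq> b" "s \<noteq> t" "u \<noteq> v" "x \<noteq> y"
    using ab st uv xy G.no_loops' H.no_loops' by auto
  note rev = G.arcs_symmetric[OF ab(1)] G.arcs_symmetric[OF st(1)]
    H.arcs_symmetric[OF uv(1)] H.arcs_symmetric[OF xy(1)]
  have m1: "edge_degree (T1 \<box> T2) (a, u) (a, v) = ?m1"
    and m2: "edge_degree (T1 \<box> T2) (s, x) (t, x) = ?m2"
    using edge_degree ab uv xy st verts by simp_all
  have "?m1 + 1 \<le> strong_chromatic_index (T1 \<box> T2)"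
    using strong_chromatic_index_square[OF P, of "(a, u)" "(a, v)" "(b, v)" "(b, u)"]
      ab(1) uv(1) rev verts neq m1 by (simp add: arcs_iff)
  moreover have "?m2 + 1 \<le> strong_chromatic_index (T1 \<box> T2)"
    using strong_chromatic_index_square[OF P, of "(s, x)" "(t, x)" "(t, y)" "(s, y)"]
      st(1) xy(1) rev verts neq m2 by (simp add: arcs_iff)
  moreover have "max ?m1 ?m2 \<le> max_edge_degree (T1 \<box> T2)"
    using edge_degree_le_max_edge_degree[OF P, of "(a, u)" "(a, v)"]
      edge_degree_le_max_edge_degree[OF P, of "(s, x)" "(t, x)"]
      ab(1) uv(1) st(1) xy(1) verts m1 m2 by (simp add: arcs_iff)
  \<comment> \<open>An edge of maximum edge degree moves in one coordinate only. Bounding the degree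
    of the fixed coordinate and the edge degree of the moving one by their maxima gives one of the
    two terms.\<close>
  moreover have "max_edge_degree (T1 \<box> T2) \<le> max ?m1 ?m2"
  proof -
    have "((a, u), (a, v)) \<in> parcs (T1 \<box> T2)"
      using uv verts by (simp add: arcs_iff)
    then have "edges (T1 \<box> T2) \<noteq> {}"
      by (auto simp: edges_def)
    then obtain p q where pq: "(p, q) \<in> parcs (T1 \<box> T2)"
      and eq: "edge_degree (T1 \<box> T2) p q = max_edge_degree (T1 \<box> T2)"
      using max_edge_degree_attained[OF P] by blast
    obtain c w d z where [simp]: "p = (c, w)" "q = (d, z)"
      by (cases p, cases q)
    from pq consider "c = d" "c \<in> pverts T1" "(w, z) \<in> parcs T2"
      | "w = z" "w \<in> pverts T2" "(c, d) \<in> parcs T1"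
      by (auto simp: arcs_iff)
    then show ?thesis
    proof cases
      case 1
      then have "max_edge_degree (T1 \<box> T2) = 2 * degree T1 c + edge_degree T2 w z"
        using eq edge_degree(1) by simp
      then show ?thesis
        using degree_le_max_degree[OF G 1(2)] edge_degree_le_max_edge_degree[OF H 1(3)] by simp
    next
      case 2
      then have "max_edge_degree (T1 \<box> T2) = 2 * degree T2 w + edge_degree T1 c d"
        using eq edge_degree(2) by simp
      then show ?thesis
        using degree_le_max_degree[OF H 2(2)] edge_degree_le_max_edge_degree[OF G 2(3)] by simp
    qed
  qed
  ultimately show ?thesis
    by (simp add: max_def split: if_splits)
qed

end
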